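(* A binary function is rankable if and only if it has no minor isomorphic to $f_\alpha$ for any real $\alpha\leq -1$.
   Context: A binary function on a finite ground set $E$ is a function $f\colon 2^E\to\mathbb{R}$ with $f(\emptyset)=1$. Its rank function $Qf\colon 2^E\to\mathbb{R}$ is $Qf(X)=\log_2\left(\frac{\sum_{Y\subseteq E} f(Y)}{\sum_{Y\subseteq E\setminus X} f(Y)}\right)$; $f$ is rankable if $Qf(X)$ is well defined for every $X\subseteq E$. For $X\subseteq E$, the contraction $f/X\colon 2^{E\setminus X}\to\mathbb{R}$ is $f/X(Y)=f(Y)$, and the deletion $f\setminus X\colon 2^{E\setminus X}\to\mathbb{R}$ is $f\setminus X(Y)=\frac{\sum_{Z\subseteq X} f(Y\cup Z)}{\sum_{Z\subseteq X} f(Z)}$, well defined exactly when the denominator is nonzero. A minor of $f$ is a well-defined binary function $(f/X)\setminus Y$ for disjoint $X,Y\subseteq E$. Two binary functions $f$ on $E$ and $f'$ on $E'$ are isomorphic if there is a bijection $\phi\colon E\to E'$ with $f(X)=f'(\phi(X))$ for all $X\subseteq E$. For $\alpha\in\mathbb{R}$, $f_\alpha$ denotes the binary function on a one-element ground set $E$ with $f_\alpha(E)=\alpha$. *)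

theory Defs
  imports Complex_Main "HOL-Library.FuncSet"
begin

text \<open>
  A function \<open>2\<^sup>E \<rightarrow> \<real>\<close> is given by its ground set \<open>E\<close> together with an \<open>f :: 'a set \<Rightarrow> real\<close>,
  of which only the values on \<open>Pow E\<close> are ever used.
\<close>

definition binary_function :: "'a set \<Rightarrow> ('a set \<Rightarrow> real) \<Rightarrow> bool" where
  "binary_function E f \<longleftrightarrow> finite E \<and> f {} = 1"

definition rank_fun :: "'a set \<Rightarrow> ('a set \<Rightarrow> real) \<Rightarrow> 'a set \<Rightarrow> real" where
  "rank_fun E f X = log 2 ((\<Sum>Y\<in>Pow E. f Y) / (\<Sum>Y\<in>Pow (E - X). f Y))"

text \<open>
  Division and \<open>log\<close> are total in HOL, so well-definedness of \<open>rank_fun E f X\<close> is spelled out: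
  the denominator is nonzero and the argument of the real logarithm is positive.
\<close>

definition rank_defined :: "'a set \<Rightarrow> ('a set \<Rightarrow> real) \<Rightarrow> 'a set \<Rightarrow> bool" where
  "rank_defined E f X \<longleftrightarrow>
     (\<Sum>Y\<in>Pow (E - X). f Y) \<noteq> 0 \<and>
     (\<Sum>Y\<in>Pow E. f Y) / (\<Sum>Y\<in>Pow (E - X). f Y) > 0"

definition rankable :: "'a set \<Rightarrow> ('a set \<Rightarrow> real) \<Rightarrow> bool" where
  "rankable E f \<longleftrightarrow> (\<forall>X. X \<subseteq> E \<longrightarrow> rank_defined E f X)"

definition contraction :: "'a set \<Rightarrow> ('a set \<Rightarrow> real) \<Rightarrow> 'a set \<Rightarrow> 'a set \<Rightarrow> real" where
  "contraction E f X = (\<lambda>Y\<in>Pow (E - X). f Y)"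

definition deletion :: "'a set \<Rightarrow> ('a set \<Rightarrow> real) \<Rightarrow> 'a set \<Rightarrow> 'a set \<Rightarrow> real" where
  "deletion E f X = (\<lambda>Y\<in>Pow (E - X). (\<Sum>Z\<in>Pow X. f (Y \<union> Z)) / (\<Sum>Z\<in>Pow X. f Z))"

definition deletion_defined :: "('a set \<Rightarrow> real) \<Rightarrow> 'a set \<Rightarrow> bool" where
  "deletion_defined f X \<longleftrightarrow> (\<Sum>Z\<in>Pow X. f Z) \<noteq> 0"

text \<open>\<open>is_minor E' f' E f\<close>: the function \<open>f'\<close> on ground set \<open>E'\<close> is a minor of \<open>f\<close> on \<open>E\<close>.\<close>

definition is_minor ::
  "'a set \<Rightarrow> ('a set \<Rightarrow> real) \<Rightarrow> 'a set \<Rightarrow> ('a set \<Rightarrow> real) \<Rightarrow> bool" where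
  "is_minor E' f' E f \<longleftrightarrow>
     (\<exists>X Y. X \<subseteq> E \<and> Y \<subseteq> E \<and> X \<inter> Y = {} \<and>
        deletion_defined (contraction E f X) Y \<and>
        E' = E - X - Y \<and> f' = deletion (E - X) (contraction E f X) Y)"

definition isomorphic ::
  "'a set \<Rightarrow> ('a set \<Rightarrow> real) \<Rightarrow> 'b set \<Rightarrow> ('b set \<Rightarrow> real) \<Rightarrow> bool" where
  "isomorphic E f E' f' \<longleftrightarrow>
     (\<exists>\<phi>. bij_betw \<phi> E E' \<and> (\<forall>X. X \<subseteq> E \<longrightarrow> f X = f' (\<phi> ` X)))"

text \<open>The function \<open>f\<^sub>\<alpha>\<close>; its one-element ground set is taken to be \<open>{()}\<close>.\<close>

definition f_alpha :: "real \<Rightarrow> unit set \<Rightarrow> real" where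
  "f_alpha \<alpha> X = (if X = {} then 1 else \<alpha>)"

end

theory Submission
  imports Defs
begin

text \<open>
  Write \<open>S A\<close> for the sum of \<open>f\<close> over the subsets of \<open>A\<close>. Since \<open>S {} = 1\<close>, rankability means that
  \<open>S\<close> is positive on all subsets of \<open>E\<close>. The one-element minor on \<open>{e}\<close> obtained by deleting \<open>Y\<close>
  takes the value \<open>S (insert e Y) / S Y - 1\<close>, which is at most \<open>-1\<close> iff \<open>S (insert e Y) / S Y \<le> 0\<close>;
  so the absence of such minors says that \<open>S\<close> stays positive as elements are added one at a time.
\<close>

lemma rankable_iff_sum_Pow_pos:
  fixes f :: "'a set \<Rightarrow> real"
  assumes "binary_function E f"
  shows "rankable E f \<longleftrightarrow> (\<forall>A. A \<subseteq> E \<longrightarrow> 0 < sum f (Pow A))"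
proof
  assume r: "rankable E f"
  have e: "sum f (Pow {}) = 1" using assms by (simp add: binary_function_def)
  \<comment> \<open>For \<open>X = E\<close> the denominator is \<open>f {} = 1\<close>, so the
    total over \<open>Pow E\<close> is itself positive. With the numerator's sign fixed, each
    quotient's positivity passes to its denominator.\<close>
  have "rank_defined E f E" using r by (simp add: rankable_def)
  then have E: "0 < sum f (Pow E)" using e by (simp add: rank_defined_def)
  show "\<forall>A. A \<subseteq> E \<longrightarrow> 0 < sum f (Pow A)"
  proof (intro allI impI)
    fix A assume "A \<subseteq> E"
    then have A: "E - (E - A) = A" by blast
    have "rank_defined E f (E - A)" using r by (simp add: rankable_def)
    then show "0 < sum f (Pow A)"
      using E by (simp add: rank_defined_def A zero_less_divide_iff)
  qed
next
  assume pos: "\<forall>A. A \<subseteq> E \<longrightarrow> 0 < sum f (Pow A)"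
  have "rank_defined E f X" for X
  proof -
    have "0 < sum f (Pow E)" "0 < sum f (Pow (E - X))" using pos by auto
    then show ?thesis by (simp add: rank_defined_def)
  qed
  then show "rankable E f" by (simp add: rankable_def)
qed

lemma sum_Pow_insert:
  fixes f :: "'a set \<Rightarrow> real"
  assumes "finite A" "e \<notin> A"
  shows "sum f (Pow (insert e A)) = sum f (Pow A) + (\<Sum>Z\<in>Pow A. f (insert e Z))"
proof -
  have inj: "inj_on (insert e) (Pow A)" using assms(2) by (auto simp: inj_on_def)
  have "sum f (Pow (insert e A)) = sum f (Pow A) + sum f (insert e ` Pow A)"
    unfolding Pow_insert using assms by (intro sum.union_disjoint) auto
  then show ?thesis by (simp add: sum.reindex[OF inj])
qed

text \<open>A one-element ground set has only two subsets, and any bijection onto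
  \<open>{()}\<close> sends them to \<open>{}\<close> and \<open>{()}\<close>. This reduces
  isomorphism to a check of two values.\<close>

lemma isomorphic_f_alpha_iff:
  "isomorphic E f {()} (f_alpha \<alpha>) \<longleftrightarrow> (\<exists>e. E = {e} \<and> f {} = 1 \<and> f {e} = \<alpha>)"
proof
  assume "isomorphic E f {()} (f_alpha \<alpha>)"
  then obtain \<phi> where bij: "bij_betw \<phi> E {()}" and f: "\<And>X. X \<subseteq> E \<Longrightarrow> f X = f_alpha \<alpha> (\<phi> ` X)"
    by (auto simp: isomorphic_def)
  from bij have "card E = 1" by (simp add: bij_betw_same_card)
  then obtain e where "E = {e}" by (auto simp: card_1_singleton_iff)
  then show "\<exists>e. E = {e} \<and> f {} = 1 \<and> f {e} = \<alpha>"
    using f[of "{}"] f[of "{e}"] by (auto simp: f_alpha_def)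
next
  assume "\<exists>e. E = {e} \<and> f {} = 1 \<and> f {e} = \<alpha>"
  then obtain e where e: "E = {e}" "f {} = 1" "f {e} = \<alpha>" by blast
  have "bij_betw (\<lambda>_. ()) E {()}" by (simp add: e bij_betw_def)
  moreover have "f X = f_alpha \<alpha> ((\<lambda>_. ()) ` X)" if "X \<subseteq> E" for X
    using that e by (auto simp: f_alpha_def subset_singleton_iff)
  ultimately show "isomorphic E f {()} (f_alpha \<alpha>)" unfolding isomorphic_def by blast
qed

text \<open>Contraction only restricts \<open>f\<close>, and is \<open>undefined\<close> outside
  \<open>Pow (E - X)\<close>; the inclusion keeps every summand inside that domain.\<close>

lemma sum_Pow_contraction:
  assumes "Y \<subseteq> E - X"
  shows "sum (contraction E f X) (Pow Y) = sum f (Pow Y)"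
  using assms by (intro sum.cong) (auto simp: contraction_def)

text \<open>The numerator of the value at \<open>{e}\<close> runs over the subsets of
  \<open>insert e Y\<close> that contain \<open>e\<close>. By \<open>sum_Pow_insert\<close> it is
  the difference of two full sums, and dividing by \<open>sum f (Pow Y)\<close> produces the
  \<open>- 1\<close>.\<close>

lemma deletion_contraction_singleton:
  fixes f :: "'a set \<Rightarrow> real"
  assumes "finite E" "X \<subseteq> E" "Y \<subseteq> E" "X \<inter> Y = {}" "E - X - Y = {e}" "sum f (Pow Y) \<noteq> 0"
  shows "deletion (E - X) (contraction E f X) Y {} = 1"
    and "deletion (E - X) (contraction E f X) Y {e} = sum f (Pow (insert e Y)) / sum f (Pow Y) - 1"
proof -
  have Y: "Y \<subseteq> E - X" and e: "e \<in> E - X" "e \<notin> Y" "finite Y"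
    using assms by (auto intro: finite_subset)
  note S = sum_Pow_contraction[OF Y, of f]
  show "deletion (E - X) (contraction E f X) Y {} = 1"
    using assms(6) S by (simp add: deletion_def)
  have "(\<Sum>Z\<in>Pow Y. contraction E f X ({e} \<union> Z)) = (\<Sum>Z\<in>Pow Y. f (insert e Z))"
    using Y e by (intro sum.cong) (auto simp: contraction_def)
  also have "\<dots> = sum f (Pow (insert e Y)) - sum f (Pow Y)"
    using sum_Pow_insert[OF e(3,2), of f] by simp
  finally show "deletion (E - X) (contraction E f X) Y {e}
      = sum f (Pow (insert e Y)) / sum f (Pow Y) - 1"
    using assms(6) S e by (simp add: deletion_def diff_divide_distrib)
qed

text \<open>A minor with ground set \<open>{e}\<close> is determined by \<open>e\<close> and the
  deleted set \<open>Y\<close>, since all other elements must be contracted. Minors thus turn into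
  ratios of consecutive sums.\<close>

lemma has_f_alpha_minor_iff:
  fixes f :: "'a set \<Rightarrow> real"
  assumes "finite E"
  shows "(\<exists>E' f'. is_minor E' f' E f \<and> isomorphic E' f' {()} (f_alpha \<alpha>)) \<longleftrightarrow>
    (\<exists>Y e. insert e Y \<subseteq> E \<and> e \<notin> Y \<and> sum f (Pow Y) \<noteq> 0 \<and>
       \<alpha> = sum f (Pow (insert e Y)) / sum f (Pow Y) - 1)"
    (is "?L \<longleftrightarrow> ?R")
proof
  assume ?L
  then obtain X Y e where XY: "X \<subseteq> E" "Y \<subseteq> E" "X \<inter> Y = {}" "E - X - Y = {e}"
    and d: "deletion_defined (contraction E f X) Y"
    and v: "deletion (E - X) (contraction E f X) Y {e} = \<alpha>"
    unfolding is_minor_def isomorphic_f_alpha_iff by blast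
  have "Y \<subseteq> E - X" using XY by blast
  then have nz: "sum f (Pow Y) \<noteq> 0"
    using d by (simp add: deletion_defined_def sum_Pow_contraction)
  have "insert e Y \<subseteq> E" "e \<notin> Y" using XY by auto
  then show ?R
    using nz v deletion_contraction_singleton(2)[OF assms XY nz] by blast
next
  assume ?R
  then obtain Y e where Ye: "insert e Y \<subseteq> E" "e \<notin> Y" and nz: "sum f (Pow Y) \<noteq> 0"
    and \<alpha>: "\<alpha> = sum f (Pow (insert e Y)) / sum f (Pow Y) - 1" by blast
  define X where "X = E - insert e Y"
  have XY: "X \<subseteq> E" "Y \<subseteq> E" "X \<inter> Y = {}" "E - X - Y = {e}"
    using Ye by (auto simp: X_def)
  have "Y \<subseteq> E - X" using XY by blast
  then have "deletion_defined (contraction E f X) Y"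
    using nz by (simp add: deletion_defined_def sum_Pow_contraction)
  then have "is_minor {e} (deletion (E - X) (contraction E f X) Y) E f"
    unfolding is_minor_def using XY by metis
  moreover have "isomorphic {e} (deletion (E - X) (contraction E f X) Y) {()} (f_alpha \<alpha>)"
    using deletion_contraction_singleton[OF assms XY nz] \<alpha>
    by (simp add: isomorphic_f_alpha_iff)
  ultimately show ?L by blast
qed

theorem theorem6:
  fixes E :: "'a set" and f :: "'a set \<Rightarrow> real"
  assumes "binary_function E f"
  shows "rankable E f \<longleftrightarrow>
    \<not> (\<exists>\<alpha>::real. \<alpha> \<le> -1 \<and>
        (\<exists>E' f'. is_minor E' f' E f \<and> isomorphic E' f' {()} (f_alpha \<alpha>)))"
proof -
  have fin: "finite E" and f0: "f {} = 1" using assms by (auto simp: binary_function_def)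
  show ?thesis
    unfolding rankable_iff_sum_Pow_pos[OF assms] has_f_alpha_minor_iff[OF fin]
  proof (intro iffI notI)
    assume pos: "\<forall>A. A \<subseteq> E \<longrightarrow> 0 < sum f (Pow A)"
    assume "\<exists>\<alpha>\<le>-1. \<exists>Y e. insert e Y \<subseteq> E \<and> e \<notin> Y \<and> sum f (Pow Y) \<noteq> 0 \<and>
      \<alpha> = sum f (Pow (insert e Y)) / sum f (Pow Y) - 1"
    then obtain Y e where Ye: "insert e Y \<subseteq> E"
      and le: "sum f (Pow (insert e Y)) / sum f (Pow Y) \<le> 0" by auto
    have "0 < sum f (Pow (insert e Y))" "0 < sum f (Pow Y)" using pos Ye by auto
    then have "0 < sum f (Pow (insert e Y)) / sum f (Pow Y)" by (rule divide_pos_pos)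
    then show False using le by linarith
  next
    assume no: "\<not> (\<exists>\<alpha>\<le>-1. \<exists>Y e. insert e Y \<subseteq> E \<and> e \<notin> Y \<and> sum f (Pow Y) \<noteq> 0 \<and>
      \<alpha> = sum f (Pow (insert e Y)) / sum f (Pow Y) - 1)"
    \<comment> \<open>The set is built up one element at a time, starting from
      \<open>f {} = 1\<close>.\<close>
    have "0 < sum f (Pow A)" if "finite A" "A \<subseteq> E" for A
      using that
    proof (induction A rule: finite_induct)
      case empty
      then show ?case by (simp add: f0)
    next
      case (insert e Y)
      then have Y: "0 < sum f (Pow Y)" by simp
      \<comment> \<open>The induction hypothesis is used twice: it makes the denominator nonzero, so
        that \<open>no\<close> applies with this value as \<alpha>, and then it carries positivity
        from the ratio to its numerator.\<close>
      have "\<not> sum f (Pow (insert e Y)) / sum f (Pow Y) - 1 \<le> -1"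
        using no insert.hyps insert.prems Y by (metis less_irrefl)
      then show ?case using Y by (simp add: not_le zero_less_divide_iff)
    qed
    then show "\<forall>A. A \<subseteq> E \<longrightarrow> 0 < sum f (Pow A)" using fin finite_subset by blast
  qed
qed

end
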